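(* For every finite simple graph $G$, the following statements are equivalent: (1) $G$ is domishold; (2) the closed neighborhood hypergraph $\mathcal{N}(G)$ is $1$-Sperner; (3) the closed neighborhood hypergraph $\mathcal{N}(G)$ is threshold; (4) the closed neighborhood hypergraph $\mathcal{N}(G)$ is $2$-asummable.
   Context: A hypergraph $\mathcal{H}=(V,E)$ consists of a finite vertex set $V$ and a set $E$ of subsets of $V$ (hyperedges). $\mathcal{H}$ is $1$-Sperner if every two distinct hyperedges $e,f$ satisfy $\min\{|e\setminus f|,|f\setminus e|\}=1$. A set $X\subseteq V$ is independent in $\mathcal{H}$ if it contains no hyperedge, and dependent otherwise. $\mathcal{H}$ is threshold if there exist $w:V\to\mathbb{Z}_{\ge0}$ and $t\in\mathbb{Z}_{\ge0}$ such that for every $X\subseteq V$, $\sum_{x\in X}w(x)\ge t$ if and only if $X$ contains some hyperedge. $\mathcal{H}$ is $2$-asummable if there are no (not necessarily distinct) independent sets $A_1,A_2$ and dependent sets $B_1,B_2$ with $\chi^{A_1}+\chi^{A_2}=\chi^{B_1}+\chi^{B_2}$, where $\chi^S$ is the characteristic vector of $S$. A dominating set of a graph $G$ is a set $D\subseteq V(G)$ such that every vertex is in $D$ or has a neighbor in $D$. $G=(V,E)$ is domishold if there exist $w:V\to\mathbb{Z}_{\ge0}$ and $t\in\mathbb{Z}_{\ge0}$ such that for every $X\subseteq V$, $\sum_{x\in X}w(x)\ge t$ if and only if $X$ is a dominating set. $N[v]$ denotes the closed neighborhood of $v$ ($v$ together with its neighbors). The closed neighborhood hypergraph $\mathcal{N}(G)$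 has vertex set $V(G)$ and as hyperedges exactly the inclusion-minimal sets among $\{N[v]: v\in V(G)\}$. *)

theory Defs
  imports "Graph_Theory.Digraph" "HOL-Library.Indicator_Function"
begin

text \<open>
  Finite simple graphs are the members of the locale \<^locale>\<open>graph\<close>: finite, loop-free
  digraphs without parallel arcs whose adjacency relation is symmetric, so that an undirected
  edge is a pair of opposite arcs. The null graph is allowed.
\<close>

record 'a pre_hypergraph =
  hverts :: "'a set"
  hedges :: "'a set set"

locale hypergraph =
  fixes H :: "'a pre_hypergraph" (structure)
  assumes finite_hverts: "finite (hverts H)"
    and hedges_subset: "hedges H \<subseteq> Pow (hverts H)"

definition one_Sperner :: "'a pre_hypergraph \<Rightarrow> bool" where
  "one_Sperner H \<longleftrightarrow>
     (\<forall>e\<in>hedges H. \<forall>f\<in>hedges H. e \<noteq> f \<longrightarrow> min (card (e - f)) (card (f - e)) = 1)"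

definition dependent_set :: "'a pre_hypergraph \<Rightarrow> 'a set \<Rightarrow> bool" where
  "dependent_set H X \<longleftrightarrow> X \<subseteq> hverts H \<and> (\<exists>e\<in>hedges H. e \<subseteq> X)"

definition independent_set :: "'a pre_hypergraph \<Rightarrow> 'a set \<Rightarrow> bool" where
  "independent_set H X \<longleftrightarrow> X \<subseteq> hverts H \<and> \<not> (\<exists>e\<in>hedges H. e \<subseteq> X)"

definition threshold :: "'a pre_hypergraph \<Rightarrow> bool" where
  "threshold H \<longleftrightarrow>
     (\<exists>(w :: 'a \<Rightarrow> nat) (t :: nat). \<forall>X\<subseteq>hverts H. (\<Sum>x\<in>X. w x) \<ge> t \<longleftrightarrow> (\<exists>e\<in>hedges H. e \<subseteq> X))"

definition two_asummable :: "'a pre_hypergraph \<Rightarrow> bool" where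
  "two_asummable H \<longleftrightarrow>
     \<not> (\<exists>A1 A2 B1 B2. independent_set H A1 \<and> independent_set H A2 \<and>
          dependent_set H B1 \<and> dependent_set H B2 \<and>
          (\<forall>x\<in>hverts H. (indicator A1 x + indicator A2 x :: nat) = indicator B1 x + indicator B2 x))"

definition dominating_set :: "('a, 'b) pre_digraph \<Rightarrow> 'a set \<Rightarrow> bool" where
  "dominating_set G D \<longleftrightarrow>
     D \<subseteq> verts G \<and> (\<forall>v\<in>verts G. v \<in> D \<or> (\<exists>u\<in>D. v \<rightarrow>\<^bsub>G\<^esub> u))"

definition domishold :: "('a, 'b) pre_digraph \<Rightarrow> bool" where
  "domishold G \<longleftrightarrow>
     (\<exists>(w :: 'a \<Rightarrow> nat) (t :: nat). \<forall>X\<subseteq>verts G. (\<Sum>x\<in>X. w x) \<ge> t \<longleftrightarrow> dominating_set G X)"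

definition closed_nbhd :: "('a, 'b) pre_digraph \<Rightarrow> 'a \<Rightarrow> 'a set" where
  "closed_nbhd G v = insert v {u \<in> verts G. v \<rightarrow>\<^bsub>G\<^esub> u}"

definition closed_nbhd_hypergraph :: "('a, 'b) pre_digraph \<Rightarrow> 'a pre_hypergraph" where
  "closed_nbhd_hypergraph G =
     \<lparr>hverts = verts G,
      hedges = {e \<in> closed_nbhd G ` verts G. \<not> (\<exists>f \<in> closed_nbhd G ` verts G. f \<subset> e)}\<rparr>"

lemma (in fin_digraph) hypergraph_closed_nbhd_hypergraph:
  "hypergraph (closed_nbhd_hypergraph G)"
  by unfold_locales (auto simp: closed_nbhd_hypergraph_def closed_nbhd_def)

end

theory Submission
  imports Defs
begin

text \<open>
  Domination and \<open>\<N>(G)\<close> are dual: \<open>D\<close> is dominating iff its complement contains no closed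
  neighborhood, so weights for one property serve for the other with threshold \<open>w(V) - t + 1\<close>.

  A 1-Sperner hypergraph with a nonempty hyperedge has a vertex \<open>z\<close>, lying in some hyperedge, such
  that \<open>e - {z} \<subseteq> f\<close> whenever \<open>z \<in> e\<close> and \<open>z \<notin> f\<close>. With \<open>V\<^sub>1\<close> the union of the sets
  \<open>e - {z}\<close> and \<open>V\<^sub>2\<close> the remaining vertices, the traces of the hyperedges through \<open>z\<close> on
  \<open>V\<^sub>1\<close> and of the others on \<open>V\<^sub>2\<close> are again 1-Sperner, and threshold weights for these two
  smaller hypergraphs can be combined.

  If \<open>\<N>(G)\<close> is 2-asummable, exchanging \<open>x\<close> and \<open>y\<close> between \<open>N[x]\<close> and \<open>N[y]\<close> shows that
  nonadjacent vertices have comparable neighborhoods. If moreover \<open>N[u]\<close> and \<open>N[v]\<close>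
  violate the 1-Sperner condition, then \<open>u\<close> and \<open>v\<close> are adjacent, and exchanging some
  \<open>a \<in> N[u] - N[v]\<close> with some \<open>b \<in> N[v] - N[u]\<close> gives two independent sets, a contradiction.
\<close>

section \<open>1-Sperner hypergraphs are threshold\<close>

lemma one_Sperner_diff_le:
  assumes "one_Sperner H" "e \<in> hedges H" "f \<in> hedges H" "e \<noteq> f"
    and "finite e" "finite f" "card e \<le> card f"
  shows "card (e - f) = 1"
proof -
  have "card (e - f) \<le> card (f - e)"
    using assms(5-7) by (simp add: card_le_sym_Diff)
  then show ?thesis
    using assms(1-4) unfolding one_Sperner_def by (metis min.absorb1)
qed

text \<open>The 1-Sperner condition sees only differences of hyperedges, so a map preserving them
  keeps it. Used below for deleting \<open>z\<close> and for deleting \<open>V1\<close>.\<close>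

lemma one_Sperner_image:
  assumes "one_Sperner H" "E \<subseteq> hedges H"
    and "\<And>e f. e \<in> E \<Longrightarrow> f \<in> E \<Longrightarrow> g e - g f = e - f"
  shows "one_Sperner \<lparr>hverts = V, hedges = g ` E\<rparr>"
  unfolding one_Sperner_def
proof (intro ballI impI)
  fix e' f' assume "e' \<in> hedges \<lparr>hverts = V, hedges = g ` E\<rparr>"
    and "f' \<in> hedges \<lparr>hverts = V, hedges = g ` E\<rparr>" and ne: "e' \<noteq> f'"
  then obtain e f where "e \<in> E" "f \<in> E" "e' = g e" "f' = g f" by auto
  with ne assms show "min (card (e' - f')) (card (f' - e')) = 1"
    unfolding one_Sperner_def by (metis subsetD)
qed

text \<open>Hyperedges are added in order of nondecreasing size, so each other hyperedge has exactly
  one vertex outside the new one \<open>f\<close>.\<close>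

lemma one_Sperner_splitting_vertex:
  assumes "finite E" "\<And>e. e \<in> E \<Longrightarrow> finite e"
    and "one_Sperner \<lparr>hverts = V, hedges = E\<rparr>" "\<Union>E \<noteq> {}"
  obtains z where "z \<in> \<Union>E" "\<And>e f. e \<in> E \<Longrightarrow> f \<in> E \<Longrightarrow> z \<in> e \<Longrightarrow> z \<notin> f \<Longrightarrow> e - {z} \<subseteq> f"
proof -
  have "\<exists>z\<in>\<Union>E. \<forall>e\<in>E. \<forall>f\<in>E. z \<in> e \<longrightarrow> z \<notin> f \<longrightarrow> e - {z} \<subseteq> f"
    using assms
  proof (induction rule: finite_ranking_induct[where f = card])
    case empty
    then show ?case by simp
  next
    case (insert f E)
    show ?case
    proof (cases "f \<in> E")
      case True
      then show ?thesis using insert.IH insert.prems by (simp add: insert_absorb)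
    next
      case False
      then have "f \<notin> E" .
      have diff: "\<exists>x. e - f = {x}" if "e \<in> E" for e
      proof -
        have ne: "e \<noteq> f" using that \<open>f \<notin> E\<close> by blast
        have "card (e - f) = 1"
          by (rule one_Sperner_diff_le[OF insert.prems(2) _ _ ne])
            (use that in \<open>simp_all add: insert.hyps insert.prems(1)\<close>)
        then show ?thesis by (simp add: card_1_singleton_iff)
      qed
      have sub: "e - {x} \<subseteq> f" if e: "e \<in> E" "x \<in> e" "x \<notin> f" for e x
      proof -
        obtain y where "e - f = {y}" using diff[OF e(1)] by blast
        moreover from this have "x = y" using e by auto
        ultimately show ?thesis by auto
      qed
      show ?thesis
      proof (cases "E = {}")
        case True
        then show ?thesis using insert.prems by auto
      next
        case False
        then obtain e where "e \<in> E" by blast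
        then have ne: "\<Union>E \<noteq> {}" using diff by blast
        have "one_Sperner \<lparr>hverts = V, hedges = E\<rparr>"
          using insert.prems unfolding one_Sperner_def by auto
        from insert.IH[OF insert.prems(1)[OF insertI2] this ne] obtain z where zE: "z \<in> \<Union>E"
          "\<forall>e\<in>E. \<forall>g\<in>E. z \<in> e \<longrightarrow> z \<notin> g \<longrightarrow> e - {z} \<subseteq> g"
          by (rule bexE)
        have z: "e - {z} \<subseteq> g" if "e \<in> E" "g \<in> E" "z \<in> e" "z \<notin> g" for e g
          by (rule zE(2)[rule_format, OF that])
        \<comment> \<open>The old \<open>z\<close> survives unless it lies in \<open>f\<close> while
          some hyperedge of \<open>E\<close> avoids it; by \<open>sub\<close>, \<open>f\<close> as
          the avoiding hyperedge is harmless.\<close>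
        show ?thesis
        proof (cases "z \<in> f \<and> (\<exists>g\<in>E. z \<notin> g)")
          case False
          have "\<forall>e\<in>insert f E. \<forall>g\<in>insert f E. z \<in> e \<longrightarrow> z \<notin> g \<longrightarrow> e - {z} \<subseteq> g"
            using z sub False by blast
          then show ?thesis using zE(1) by blast
        next
          case True
          then obtain g0 where g0: "z \<in> f" "g0 \<in> E" "z \<notin> g0" by blast
          obtain x where x: "g0 - f = {x}" using diff g0 by blast
          \<comment> \<open>The vertex missed by \<open>f\<close> in a hyperedge through \<open>z\<close> lies in every hyperedge avoiding
            \<open>z\<close>, so all hyperedges other than \<open>f\<close> meet the complement of \<open>f\<close> in the same vertex.\<close>
          have through: "e - f = {x}" if e: "e \<in> E" "z \<in> e" for e
          proof -
            obtain y where y: "e - f = {y}" using diff e by blast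
            then have "y \<in> e" "y \<notin> f" by auto
            then have "y \<in> g0 - f" using z[OF e(1) g0(2) e(2) g0(3)] g0(1) by blast
            then show ?thesis using x y by simp
          qed
          obtain e0 where e0: "e0 \<in> E" "z \<in> e0" using zE(1) by blast
          have all: "e - f = {x}" if e: "e \<in> E" for e
          proof (cases "z \<in> e")
            case False
            have "x \<in> e0" "x \<notin> f" using through[OF e0] by auto
            then have "x \<in> e - f" using z[OF e0(1) e e0(2) False] g0(1) by blast
            then show ?thesis using diff[OF e] by (metis singletonD)
          qed (use through e in blast)
          have "\<forall>e\<in>insert f E. \<forall>g\<in>insert f E. x \<in> e \<longrightarrow> x \<notin> g \<longrightarrow> e - {x} \<subseteq> g"
            using all by fastforce
          moreover have "x \<in> e0" using all[OF e0(1)] by auto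
          ultimately show ?thesis using e0(1) by blast
        qed
      qed
    qed
  qed
  then obtain z where "z \<in> \<Union>E" "\<forall>e\<in>E. \<forall>f\<in>E. z \<in> e \<longrightarrow> z \<notin> f \<longrightarrow> e - {z} \<subseteq> f"
    by (rule bexE)
  then show thesis using that[of z] by simp
qed

section \<open>Positive weights and gluing of threshold hypergraphs\<close>

text \<open>Scaling by \<open>?K\<close> before adding 1 to every weight keeps all comparisons,
  since the added total \<open>card X\<close> stays below \<open>?K\<close>. Gluing relies on
  positivity.\<close>

lemma threshold_positive_weights:
  assumes "finite (hverts H)" "threshold H"
  obtains w :: "'a \<Rightarrow> nat" and t :: nat where "\<And>x. w x > 0"
    "\<And>X. X \<subseteq> hverts H \<Longrightarrow> sum w X \<ge> t \<longleftrightarrow> (\<exists>e\<in>hedges H. e \<subseteq> X)"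
proof -
  obtain w :: "'a \<Rightarrow> nat" and t :: nat where wt:
    "\<And>X. X \<subseteq> hverts H \<Longrightarrow> sum w X \<ge> t \<longleftrightarrow> (\<exists>e\<in>hedges H. e \<subseteq> X)"
    using assms(2) unfolding threshold_def by metis
  let ?K = "Suc (card (hverts H))"
  have "sum (\<lambda>x. ?K * w x + 1) X \<ge> ?K * t \<longleftrightarrow> (\<exists>e\<in>hedges H. e \<subseteq> X)"
    if X: "X \<subseteq> hverts H" for X
  proof -
    have s: "sum (\<lambda>x. ?K * w x + 1) X = ?K * sum w X + card X"
      by (simp only: sum.distrib sum_distrib_left card_eq_sum)
    have c: "card X < ?K" using card_mono[OF assms(1) X] by simp
    have "?K * sum w X + card X \<ge> ?K * t \<longleftrightarrow> sum w X \<ge> t"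
    proof
      assume le: "?K * t \<le> ?K * sum w X + card X"
      show "t \<le> sum w X"
      proof (rule ccontr)
        assume "\<not> t \<le> sum w X"
        then have "?K * Suc (sum w X) \<le> ?K * t" by (intro mult_le_mono2) simp
        then show False using le c by simp
      qed
    next
      assume "t \<le> sum w X"
      then show "?K * t \<le> ?K * sum w X + card X"
        by (meson mult_le_mono2 trans_le_add1)
    qed
    with s wt[OF X] show ?thesis by simp
  qed
  then show thesis by (intro that[of "\<lambda>x. ?K * w x + 1" "?K * t"]) simp_all
qed

text \<open>Weight on \<open>V1\<close> is scaled to outweigh all of \<open>V2\<close>, and
  \<open>z\<close> lowers the remaining demand from \<open>T\<close> to \<open>M * t1\<close>, where
  only the weight on \<open>V1\<close> decides.\<close>

lemma threshold_glue:
  fixes V1 V2 :: "'a set"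
  assumes fin: "finite V1" "finite V2" and disj: "V1 \<inter> V2 = {}" "z \<notin> V1" "z \<notin> V2"
    and sub: "E1 \<subseteq> Pow V1" "E2 \<subseteq> Pow V2" and ne: "E1 \<noteq> {}"
    and thr: "threshold \<lparr>hverts = V1, hedges = E1\<rparr>" "threshold \<lparr>hverts = V2, hedges = E2\<rparr>"
  shows "threshold \<lparr>hverts = insert z (V1 \<union> V2),
    hedges = insert z ` E1 \<union> (\<union>) V1 ` E2\<rparr>"
proof -
  obtain w1 :: "'a \<Rightarrow> nat" and t1 :: nat where w1: "\<And>x. w1 x > 0"
    "\<And>X. X \<subseteq> V1 \<Longrightarrow> sum w1 X \<ge> t1 \<longleftrightarrow> (\<exists>e\<in>E1. e \<subseteq> X)"
    using threshold_positive_weights[OF _ thr(1)] fin unfolding pre_hypergraph.simps by metis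
  obtain w2 :: "'a \<Rightarrow> nat" and t2 :: nat where w2: "\<And>x. w2 x > 0"
    "\<And>X. X \<subseteq> V2 \<Longrightarrow> sum w2 X \<ge> t2 \<longleftrightarrow> (\<exists>e\<in>E2. e \<subseteq> X)"
    using threshold_positive_weights[OF _ thr(2)] fin unfolding pre_hypergraph.simps by metis
  \<comment> \<open>\<open>M\<close> exceeds the total weight of \<open>V2\<close>, so \<open>V2\<close> only matters once \<open>V1\<close> is full.\<close>
  define M where "M = Suc (sum w2 V2)"
  define T where "T = M * sum w1 V1 + t2"
  define w where "w x = (if x = z then T - M * t1 else if x \<in> V1 then M * w1 x else w2 x)" for x
  \<comment> \<open>As \<open>E1\<close> is nonempty, \<open>V1\<close> contains one of its
    hyperedges; hence the subtraction in the weight of \<open>z\<close> does not truncate.\<close>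
  have "t1 \<le> sum w1 V1" using w1(2)[of V1] ne sub by blast
  then have T: "M * t1 \<le> T" unfolding T_def by (meson mult_le_mono2 trans_le_add1)
  have "sum w X \<ge> T \<longleftrightarrow> (\<exists>e\<in>insert z ` E1 \<union> (\<union>) V1 ` E2. e \<subseteq> X)"
    if X: "X \<subseteq> insert z (V1 \<union> V2)" for X
  proof -
    define X1 where "X1 = X \<inter> V1"
    define X2 where "X2 = X \<inter> V2"
    have X12: "X1 \<subseteq> V1" "X2 \<subseteq> V2" "finite X1" "finite X2"
      using fin by (auto simp: X1_def X2_def)
    have "sum w X = sum w (X \<inter> {z}) + sum w (X1 \<union> X2)"
      using X X12 disj by (subst sum.union_disjoint[symmetric])
        (auto simp: X1_def X2_def intro!: sum.cong)
    also have "sum w (X1 \<union> X2) = sum w X1 + sum w X2"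
      using X12 disj by (intro sum.union_disjoint) auto
    also have "sum w X1 = M * sum w1 X1"
      unfolding sum_distrib_left using X12 disj by (intro sum.cong) (auto simp: w_def)
    also have "sum w X2 = sum w2 X2"
      using X12 disj by (intro sum.cong) (auto simp: w_def)
    also have "sum w (X \<inter> {z}) = (if z \<in> X then T - M * t1 else 0)"
      by (simp add: w_def)
    finally have s: "sum w X = (if z \<in> X then T - M * t1 else 0) + (M * sum w1 X1 + sum w2 X2)" .
    have small: "sum w2 X2 < M"
      unfolding M_def using sum_mono2[OF fin(2) X12(2), of w2] by simp
    have step: "M * i + sum w2 X2 < M * j" if "i < j" for i j :: nat
    proof -
      have "M * i + sum w2 X2 < M * Suc i" using small by simp
      also have "\<dots> \<le> M * j" using that by (intro mult_le_mono2) simp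
      finally show ?thesis .
    qed
    have sub1: "insert z e \<subseteq> X \<longleftrightarrow> z \<in> X \<and> e \<subseteq> X1" if "e \<in> E1" for e
      using that sub by (auto simp: X1_def)
    have sub2: "V1 \<union> e \<subseteq> X \<longleftrightarrow> X1 = V1 \<and> e \<subseteq> X2" if "e \<in> E2" for e
      using that sub by (auto simp: X1_def X2_def)
    have "(\<exists>e\<in>insert z ` E1 \<union> (\<union>) V1 ` E2. e \<subseteq> X) \<longleftrightarrow>
      (\<exists>e\<in>E1. insert z e \<subseteq> X) \<or> (\<exists>e\<in>E2. V1 \<union> e \<subseteq> X)" by blast
    also have "\<dots> \<longleftrightarrow> z \<in> X \<and> sum w1 X1 \<ge> t1 \<or> X1 = V1 \<and> sum w2 X2 \<ge> t2"
      using w1(2)[OF X12(1)] w2(2)[OF X12(2)] sub1 sub2 by auto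
    also have "\<dots> \<longleftrightarrow> sum w X \<ge> T"
    proof (cases "z \<in> X")
      case True
      have "T - M * t1 + (M * sum w1 X1 + sum w2 X2) \<ge> T \<longleftrightarrow> M * sum w1 X1 + sum w2 X2 \<ge> M * t1"
        using T by linarith
      also have "\<dots> \<longleftrightarrow> sum w1 X1 \<ge> t1"
        using step[of "sum w1 X1" t1] by (meson mult_le_mono2 not_le trans_le_add1)
      \<comment> \<open>The alternative \<open>X1 = V1\<close> is absorbed, as \<open>V1\<close>
        itself has weight at least \<open>t1\<close>.\<close>
      finally show ?thesis
        using True s \<open>t1 \<le> sum w1 V1\<close> by auto
    next
      case False
      show ?thesis
      proof (cases "X1 = V1")
        case True
        then show ?thesis using False s by (simp add: T_def)
      next
        case ne: False
        \<comment> \<open>Positive weights make a proper subset of \<open>V1\<close> strictly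
          lighter, and by \<open>step\<close> no weight on \<open>V2\<close> makes up for
          it.\<close>
        then have "sum w1 X1 < sum w1 V1"
          using X12 fin w1(1) by (meson psubsetI psubset_imp_ex_mem sum_strict_mono2
            zero_le DiffE)
        then have "sum w X < T"
          using step False s unfolding T_def by (simp add: trans_less_add1)
        then show ?thesis using ne False by simp
      qed
    qed
    finally show ?thesis by simp
  qed
  then show ?thesis unfolding threshold_def by auto
qed

lemma one_Sperner_imp_threshold:
  assumes "finite V" "E \<subseteq> Pow V" "one_Sperner \<lparr>hverts = V, hedges = E\<rparr>"
  shows "threshold \<lparr>hverts = V, hedges = E\<rparr>"
  using assms
proof (induction "card V" arbitrary: V E rule: less_induct)
  case less
  show ?case
  proof (cases "\<Union>E = {}")
    case True
    \<comment> \<open>No vertex is covered, so no set is dependent or all are: zero weights with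
      threshold 1 or 0.\<close>
    then have "E \<subseteq> {{}}" by blast
    then consider "E = {}" | "E = {{}}" by (auto simp: subset_singleton_iff)
    then show ?thesis
    proof cases
      case 1
      then show ?thesis
        unfolding threshold_def by (intro exI[of _ "\<lambda>_. 0"] exI[of _ 1]) simp
    next
      case 2
      then show ?thesis
        unfolding threshold_def by (intro exI[of _ "\<lambda>_. 0"] exI[of _ 0]) simp
    qed
  next
    case False
    have fin: "finite E" "\<And>e. e \<in> E \<Longrightarrow> finite e"
      using less.prems by (auto simp: finite_subset intro: finite_subset)
    obtain z where z: "z \<in> \<Union>E"
      "\<And>e f. e \<in> E \<Longrightarrow> f \<in> E \<Longrightarrow> z \<in> e \<Longrightarrow> z \<notin> f \<Longrightarrow> e - {z} \<subseteq> f"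
      using one_Sperner_splitting_vertex[OF fin less.prems(3) False] by metis
    define F1 where "F1 = {e \<in> E. z \<in> e}"
    define F2 where "F2 = {e \<in> E. z \<notin> e}"
    define V1 where "V1 = \<Union>F1 - {z}"
    define V2 where "V2 = V - insert z V1"
    define E1 where "E1 = (\<lambda>e. e - {z}) ` F1"
    define E2 where "E2 = (\<lambda>e. e - V1) ` F2"
    have V: "z \<in> V" "insert z (V1 \<union> V2) = V"
      using less.prems z by (auto simp: V1_def V2_def F1_def)
    \<comment> \<open>This is the choice of \<open>z\<close>; it makes deleting \<open>V1\<close>
      from the hyperedges in \<open>F2\<close> reversible and keeps their differences.\<close>
    have V1_sub: "V1 \<subseteq> f" if "f \<in> F2" for f
      using z(2) that by (force simp: V1_def F1_def F2_def)
    have card: "card V1 < card V" "card V2 < card V"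
      using V less.prems(1)
      by (auto intro!: psubset_card_mono simp: V1_def V2_def)
    have fV: "finite V1" "finite V2"
      using V(2) less.prems(1) by (metis finite_Un finite_insert)+
    have E1: "E1 \<subseteq> Pow V1" and E2: "E2 \<subseteq> Pow V2"
      using less.prems by (auto simp: E1_def E2_def V1_def V2_def F1_def F2_def)
    have "one_Sperner \<lparr>hverts = V1, hedges = E1\<rparr>"
      unfolding E1_def by (rule one_Sperner_image[OF less.prems(3)]) (auto simp: F1_def)
    then have thr1: "threshold \<lparr>hverts = V1, hedges = E1\<rparr>"
      using less.hyps card fV E1 by blast
    have "one_Sperner \<lparr>hverts = V2, hedges = E2\<rparr>"
      unfolding E2_def
    proof (rule one_Sperner_image[OF less.prems(3)])
      show "e - V1 - (f - V1) = e - f" if "e \<in> F2" "f \<in> F2" for e f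
        using V1_sub that by blast
    qed (auto simp: F2_def)
    then have thr2: "threshold \<lparr>hverts = V2, hedges = E2\<rparr>"
      using less.hyps card fV E2 by blast
    have "insert z ` E1 = F1"
      by (force simp: E1_def F1_def image_image insert_absorb)
    moreover have "(\<union>) V1 ` E2 = F2"
      using V1_sub by (force simp: E2_def image_image Un_absorb1)
    ultimately have E: "insert z ` E1 \<union> (\<union>) V1 ` E2 = E"
      by (auto simp: F1_def F2_def)
    have "E1 \<noteq> {}" using z(1) by (auto simp: E1_def F1_def)
    then have "threshold \<lparr>hverts = insert z (V1 \<union> V2),
      hedges = insert z ` E1 \<union> (\<union>) V1 ` E2\<rparr>"
      using fV E1 E2 thr1 thr2 by (intro threshold_glue) (auto simp: V1_def V2_def)
    then show ?thesis using V E by simp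
  qed
qed

section \<open>2-asummability\<close>

text \<open>Weight is linear in the characteristic vector: two independent sets together weigh less
  than \<open>2 * t\<close>, two dependent ones at least \<open>2 * t\<close>.\<close>

lemma threshold_imp_two_asummable:
  assumes fin: "finite (hverts H)" and "threshold H"
  shows "two_asummable H"
  unfolding two_asummable_def
proof (intro notI, elim exE conjE)
  fix A1 A2 B1 B2
  assume A: "independent_set H A1" "independent_set H A2"
    and B: "dependent_set H B1" "dependent_set H B2"
    and eq: "\<forall>x\<in>hverts H. (indicator A1 x + indicator A2 x :: nat) = indicator B1 x + indicator B2 x"
  obtain w :: "'a \<Rightarrow> nat" and t :: nat where wt:
    "\<And>X. X \<subseteq> hverts H \<Longrightarrow> sum w X \<ge> t \<longleftrightarrow> (\<exists>e\<in>hedges H. e \<subseteq> X)"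
    using assms(2) unfolding threshold_def by metis
  have ind: "sum w X = (\<Sum>x\<in>hverts H. w x * indicator X x)" if "X \<subseteq> hverts H" for X
    using that fin by (simp add: sum_mult_indicator Int_absorb1)
  have sub: "A1 \<subseteq> hverts H" "A2 \<subseteq> hverts H" "B1 \<subseteq> hverts H" "B2 \<subseteq> hverts H"
    using A B by (auto simp: independent_set_def dependent_set_def)
  have "sum w A1 + sum w A2 = (\<Sum>x\<in>hverts H. w x * (indicator A1 x + indicator A2 x))"
    by (simp add: ind sub distrib_left sum.distrib)
  also have "\<dots> = (\<Sum>x\<in>hverts H. w x * (indicator B1 x + indicator B2 x))"
    using eq by simp
  also have "\<dots> = sum w B1 + sum w B2"
    by (simp add: ind sub distrib_left sum.distrib)
  finally have "sum w A1 + sum w A2 = sum w B1 + sum w B2" .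
  moreover have "sum w A1 < t" "sum w A2 < t"
    using A sub wt by (auto simp: independent_set_def not_le[symmetric])
  moreover have "sum w B1 \<ge> t" "sum w B2 \<ge> t"
    using B sub wt by (auto simp: dependent_set_def)
  ultimately show False by linarith
qed

text \<open>Swapping \<open>a\<close> and \<open>b\<close> preserves the sum of the characteristic
  vectors, so the two new sets cannot both be independent.\<close>

lemma two_asummable_exchange:
  assumes "two_asummable H" "dependent_set H B1" "dependent_set H B2"
    and "a \<in> B1 - B2" "b \<in> B2 - B1"
  shows "dependent_set H (insert b (B1 - {a})) \<or> dependent_set H (insert a (B2 - {b}))"
proof (rule ccontr)
  assume "\<not> ?thesis"
  moreover have "insert b (B1 - {a}) \<subseteq> hverts H" "insert a (B2 - {b}) \<subseteq> hverts H"
    using assms by (auto simp: dependent_set_def)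
  ultimately have "independent_set H (insert b (B1 - {a}))" "independent_set H (insert a (B2 - {b}))"
    by (auto simp: dependent_set_def independent_set_def)
  moreover have "\<forall>x\<in>hverts H. (indicator (insert b (B1 - {a})) x + indicator (insert a (B2 - {b})) x :: nat)
      = indicator B1 x + indicator B2 x"
    using assms by (auto simp: indicator_def)
  ultimately show False
    using assms unfolding two_asummable_def by blast
qed

section \<open>Closed neighborhoods\<close>

lemma (in graph) mem_closed_nbhd_sym:
  assumes "x \<in> verts G" "y \<in> verts G"
  shows "y \<in> closed_nbhd G x \<longleftrightarrow> x \<in> closed_nbhd G y"
proof -
  have "x \<rightarrow>\<^bsub>G\<^esub> y \<longleftrightarrow> y \<rightarrow>\<^bsub>G\<^esub> x"
    using arcs_ends_symmetric[OF sym_arcs, of x y] arcs_ends_symmetric[OF sym_arcs, of y x]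
    by (rule iffI)
  then show ?thesis using assms by (auto simp: closed_nbhd_def)
qed

lemma self_mem_closed_nbhd: "x \<in> closed_nbhd G x"
  by (simp add: closed_nbhd_def)

lemma closed_nbhd_subset: "x \<in> verts G \<Longrightarrow> closed_nbhd G x \<subseteq> verts G"
  by (auto simp: closed_nbhd_def)

lemma hverts_closed_nbhd_hypergraph [simp]: "hverts (closed_nbhd_hypergraph G) = verts G"
  by (simp add: closed_nbhd_hypergraph_def)

text \<open>By finiteness every closed neighborhood contains a minimal one, so minimality can be
  ignored when testing dependence.\<close>

lemma (in fin_digraph) contains_hedge_iff:
  "(\<exists>e\<in>hedges (closed_nbhd_hypergraph G). e \<subseteq> X) \<longleftrightarrow> (\<exists>x\<in>verts G. closed_nbhd G x \<subseteq> X)"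
proof
  assume "\<exists>x\<in>verts G. closed_nbhd G x \<subseteq> X"
  then obtain x where x: "x \<in> verts G" "closed_nbhd G x \<subseteq> X" by blast
  obtain e where e: "e \<in> closed_nbhd G ` verts G" "e \<subseteq> closed_nbhd G x"
    "\<forall>f\<in>closed_nbhd G ` verts G. f \<subseteq> e \<longrightarrow> e = f"
    using finite_has_minimal2[OF finite_imageI[OF finite_verts] imageI[OF x(1), of "closed_nbhd G"]]
    by (elim bexE conjE)
  then have "e \<in> hedges (closed_nbhd_hypergraph G)"
    unfolding closed_nbhd_hypergraph_def by auto
  then show "\<exists>e\<in>hedges (closed_nbhd_hypergraph G). e \<subseteq> X" using e x by blast
qed (auto simp: closed_nbhd_hypergraph_def)

lemma (in fin_digraph) dependent_closed_nbhd_iff: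
  "dependent_set (closed_nbhd_hypergraph G) X \<longleftrightarrow>
    X \<subseteq> verts G \<and> (\<exists>x\<in>verts G. closed_nbhd G x \<subseteq> X)"
  by (simp add: dependent_set_def contains_hedge_iff)

lemma (in fin_digraph) dependent_closed_nbhd:
  assumes "x \<in> verts G"
  shows "dependent_set (closed_nbhd_hypergraph G) (closed_nbhd G x)"
  using assms closed_nbhd_subset[OF assms] by (auto simp: dependent_closed_nbhd_iff)

section \<open>Domishold graphs and threshold closed neighborhood hypergraphs\<close>

lemma (in graph) dominating_set_iff:
  assumes "D \<subseteq> verts G"
  shows "dominating_set G D \<longleftrightarrow> \<not> (\<exists>e\<in>hedges (closed_nbhd_hypergraph G). e \<subseteq> verts G - D)"
proof -
  have "closed_nbhd G x \<subseteq> verts G - D \<longleftrightarrow> \<not> (x \<in> D \<or> (\<exists>u\<in>D. x \<rightarrow>\<^bsub>G\<^esub> u))"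
    if "x \<in> verts G" for x
    using that assms unfolding closed_nbhd_def by auto
  then show ?thesis
    using assms by (simp add: contains_hedge_iff dominating_set_def)
qed

text \<open>For passing to complements: \<open>Suc\<close> turns the strict bound on
  \<open>X\<close> into a weak one on \<open>V - X\<close>, and the bound on \<open>t\<close> keeps
  the subtraction exact.\<close>

lemma sum_Diff_ge_iff:
  fixes w :: "'a \<Rightarrow> nat"
  assumes "finite V" "X \<subseteq> V" "t \<le> Suc (sum w V)"
  shows "sum w (V - X) \<ge> Suc (sum w V) - t \<longleftrightarrow> \<not> sum w X \<ge> t"
proof -
  have "sum w V = sum w (V - X) + sum w X" using sum.subset_diff assms(1,2) by metis
  then show ?thesis using assms(3) by linarith
qed

lemma (in graph) domishold_iff_threshold:
  "domishold G \<longleftrightarrow> threshold (closed_nbhd_hypergraph G)"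
proof
  assume "domishold G"
  then obtain w :: "'a \<Rightarrow> nat" and t :: nat where wt:
    "\<And>X. X \<subseteq> verts G \<Longrightarrow> sum w X \<ge> t \<longleftrightarrow> dominating_set G X"
    unfolding domishold_def by metis
  have "dominating_set G (verts G)" by (simp add: dominating_set_def)
  then have t: "t \<le> Suc (sum w (verts G))" using wt[of "verts G"] by simp
  have "sum w X \<ge> Suc (sum w (verts G)) - t \<longleftrightarrow> (\<exists>e\<in>hedges (closed_nbhd_hypergraph G). e \<subseteq> X)"
    if X: "X \<subseteq> verts G" for X
    using sum_Diff_ge_iff[OF finite_verts _ t, of "verts G - X"] wt[of "verts G - X"]
      dominating_set_iff[of "verts G - X"] X by (simp add: double_diff)
  then show "threshold (closed_nbhd_hypergraph G)"
    unfolding threshold_def by auto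
next
  assume "threshold (closed_nbhd_hypergraph G)"
  then obtain w :: "'a \<Rightarrow> nat" and t :: nat where wt:
    "\<And>X. X \<subseteq> verts G \<Longrightarrow> sum w X \<ge> t \<longleftrightarrow> (\<exists>e\<in>hedges (closed_nbhd_hypergraph G). e \<subseteq> X)"
    unfolding threshold_def by auto
  \<comment> \<open>On the null graph there is no hyperedge and \<open>t\<close> can be arbitrarily
    large; capping it just above the total weight changes no comparison.\<close>
  define s where "s = min t (Suc (sum w (verts G)))"
  have s: "sum w X \<ge> s \<longleftrightarrow> sum w X \<ge> t" if "X \<subseteq> verts G" for X
    using sum_mono2[OF finite_verts that, of w] by (auto simp: s_def)
  have "sum w X \<ge> Suc (sum w (verts G)) - s \<longleftrightarrow> dominating_set G X" if X: "X \<subseteq> verts G" for X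
    using sum_Diff_ge_iff[OF finite_verts, of "verts G - X" s w] wt[of "verts G - X"]
      s[of "verts G - X"] dominating_set_iff[OF X] X by (simp add: double_diff s_def)
  then show "domishold G" unfolding domishold_def by auto
qed

section \<open>From 2-asummable to 1-Sperner\<close>

lemma (in graph) two_asummable_nonadjacent_nested:
  assumes "two_asummable (closed_nbhd_hypergraph G)"
    and xy: "x \<in> verts G" "y \<in> verts G" "y \<notin> closed_nbhd G x"
  shows "closed_nbhd G x \<subseteq> insert x (closed_nbhd G y) \<or> closed_nbhd G y \<subseteq> insert y (closed_nbhd G x)"
proof -
  have key: "closed_nbhd G q \<subseteq> insert q (closed_nbhd G p)"
    if pq: "p \<in> verts G" and
      dep: "dependent_set (closed_nbhd_hypergraph G) (insert q (closed_nbhd G p - {p}))"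
      and "p \<noteq> q" for p q
  proof -
    obtain r where r: "r \<in> verts G" "closed_nbhd G r \<subseteq> insert q (closed_nbhd G p - {p})"
      using dep unfolding dependent_closed_nbhd_iff by blast
    \<comment> \<open>\<open>r\<close> belongs to its own closed neighborhood but, missing
      \<open>p\<close>, not to that of \<open>p\<close>; only \<open>q\<close> is left.\<close>
    then have "p \<notin> closed_nbhd G r" using \<open>p \<noteq> q\<close> by blast
    then have "r \<notin> closed_nbhd G p" using mem_closed_nbhd_sym[of p r] pq r(1) by simp
    then have "r = q" using r(2) self_mem_closed_nbhd[of r G] by blast
    then show ?thesis using r by blast
  qed
  have "x \<notin> closed_nbhd G y" "x \<noteq> y"
    using xy mem_closed_nbhd_sym self_mem_closed_nbhd[of x G] by auto
  moreover have "dependent_set (closed_nbhd_hypergraph G) (closed_nbhd G x)"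
    "dependent_set (closed_nbhd_hypergraph G) (closed_nbhd G y)"
    using xy dependent_closed_nbhd by simp_all
  ultimately have "dependent_set (closed_nbhd_hypergraph G) (insert y (closed_nbhd G x - {x})) \<or>
    dependent_set (closed_nbhd_hypergraph G) (insert x (closed_nbhd G y - {y}))"
    using xy self_mem_closed_nbhd by (intro two_asummable_exchange[OF assms(1)]) auto
  then show ?thesis
    using key[of x y] key[of y x] xy(1,2) \<open>x \<noteq> y\<close> by argo
qed

lemma (in graph) two_asummable_imp_one_Sperner:
  assumes asum: "two_asummable (closed_nbhd_hypergraph G)"
  shows "one_Sperner (closed_nbhd_hypergraph G)"
proof (rule ccontr)
  note sym = mem_closed_nbhd_sym
  note self = self_mem_closed_nbhd[of _ G]
  note nested = two_asummable_nonadjacent_nested[OF asum]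
  assume "\<not> ?thesis"
  then obtain e f where ef: "e \<in> hedges (closed_nbhd_hypergraph G)"
    "f \<in> hedges (closed_nbhd_hypergraph G)" "e \<noteq> f" "min (card (e - f)) (card (f - e)) \<noteq> 1"
    unfolding one_Sperner_def by blast
  then obtain u v where uv: "u \<in> verts G" "v \<in> verts G" "e = closed_nbhd G u" "f = closed_nbhd G v"
    by (auto simp: closed_nbhd_hypergraph_def)
  have "finite e" "finite f"
    using uv closed_nbhd_subset finite_verts finite_subset by metis+
  \<comment> \<open>Minimality makes both differences nonempty, so a violation leaves at least two
    vertices in each.\<close>
  moreover have "e - f \<noteq> {}" "f - e \<noteq> {}"
    using ef(1-3) by (auto simp: closed_nbhd_hypergraph_def)
  ultimately have "card (e - f) \<noteq> 0" "card (f - e) \<noteq> 0" by auto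
  with ef(4) have "card (e - f) \<noteq> 1" "card (f - e) \<noteq> 1" by linarith+
  moreover have "\<exists>x\<in>S. x \<noteq> y" if "S \<noteq> {}" "card S \<noteq> 1" for S and y :: 'a
  proof (rule ccontr)
    assume "\<not> ?thesis"
    with \<open>S \<noteq> {}\<close> have "S = {y}" by auto
    with \<open>card S \<noteq> 1\<close> show False by simp
  qed
  ultimately have two: "\<exists>x\<in>e - f. x \<noteq> y" "\<exists>x\<in>f - e. x \<noteq> y" for y
    using \<open>e - f \<noteq> {}\<close> \<open>f - e \<noteq> {}\<close> by simp_all
  \<comment> \<open>Otherwise nestedness would confine \<open>e - f\<close> to \<open>{u}\<close> or
    \<open>f - e\<close> to \<open>{v}\<close>.\<close>
  have adj: "v \<in> closed_nbhd G u"
    using nested[of u v] two(1)[of u] two(2)[of v] uv by blast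
  \<comment> \<open>For nonadjacent \<open>a\<close> and \<open>b\<close>, the vertices
    \<open>u\<close> and \<open>v\<close> would witness that their neighborhoods are
    incomparable.\<close>
  have full: "b \<in> closed_nbhd G a" if "a \<in> e - f" "b \<in> f - e" for a b
  proof (rule ccontr)
    assume nab: "b \<notin> closed_nbhd G a"
    have ab: "a \<in> verts G" "b \<in> verts G"
      using that uv closed_nbhd_subset[of u G] closed_nbhd_subset[of v G] by blast+
    have "u \<in> closed_nbhd G a" "u \<notin> closed_nbhd G b" "v \<in> closed_nbhd G b" "v \<notin> closed_nbhd G a"
      using that uv(3,4) sym[OF uv(1)] sym[OF uv(2)] ab by auto
    moreover have "u \<noteq> a" "v \<noteq> b" using that uv(3,4) adj sym[OF uv(1,2)] by auto
    ultimately show False using nested[OF ab nab] by blast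
  qed
  \<comment> \<open>Stated for general \<open>p\<close> and \<open>q\<close> to serve both exchanged
    sets; \<open>two\<close> supplies the spare vertex \<open>b'\<close>.\<close>
  have key: "\<not> dependent_set (closed_nbhd_hypergraph G) (insert b (closed_nbhd G p - {a}))"
    if pq: "p \<in> verts G" "q \<in> verts G" "q \<in> closed_nbhd G p"
      and ab: "a \<in> closed_nbhd G p - closed_nbhd G q" "b \<in> closed_nbhd G q - closed_nbhd G p"
        "b' \<in> closed_nbhd G q - closed_nbhd G p" "b' \<noteq> b"
      and full: "\<And>x y. x \<in> closed_nbhd G p - closed_nbhd G q \<Longrightarrow>
        y \<in> closed_nbhd G q - closed_nbhd G p \<Longrightarrow> y \<in> closed_nbhd G x"
    for p q a b b'
  proof
    assume "dependent_set (closed_nbhd_hypergraph G) (insert b (closed_nbhd G p - {a}))"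
    then obtain x where x: "x \<in> verts G" "closed_nbhd G x \<subseteq> insert b (closed_nbhd G p - {a})"
      unfolding dependent_closed_nbhd_iff by blast
    have V: "a \<in> verts G" "b \<in> verts G" "b' \<in> verts G"
      using ab pq closed_nbhd_subset[of p G] closed_nbhd_subset[of q G] by blast+
    have ax: "a \<notin> closed_nbhd G x" "b' \<notin> closed_nbhd G x" using x ab by blast+
    \<comment> \<open>\<open>b\<close> is adjacent to \<open>a\<close>, so \<open>x\<close> is not
      \<open>b\<close> and lies in the neighborhood of \<open>p\<close>; outside that of
      \<open>q\<close> it would be adjacent to \<open>b'\<close>.\<close>
    then have "x \<noteq> b" using full[OF ab(1,2)] sym[OF V(1,2)] by auto
    then have xp: "x \<in> closed_nbhd G p" using x(2) self[of x] by blast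
    then have "x \<in> closed_nbhd G q" using full[of x b'] ab ax by blast
    then have "q \<in> closed_nbhd G x" using sym[OF x(1) pq(2)] by simp
    moreover have "q \<notin> closed_nbhd G a" using ab(1) sym[OF V(1) pq(2)] by simp
    moreover have "b' \<in> closed_nbhd G a" using full ab by blast
    moreover have "q \<noteq> x" using ab ax by blast
    moreover have "b' \<noteq> a" using ab by blast
    \<comment> \<open>\<open>q\<close> and \<open>b'\<close> show that the nonadjacent vertices \<open>x\<close> and \<open>a\<close> are not comparable.\<close>
    ultimately show False using nested[OF x(1) V(1) ax(1)] ax by blast
  qed
  obtain a a' b b' where ab: "a \<in> e - f" "a' \<in> e - f" "a' \<noteq> a" "b \<in> f - e" "b' \<in> f - e" "b' \<noteq> b"
    using two by metis
  have "\<not> dependent_set (closed_nbhd_hypergraph G) (insert b (e - {a}))"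
    using key[of u v a b b'] uv adj ab full by blast
  moreover have "\<not> dependent_set (closed_nbhd_hypergraph G) (insert a (f - {b}))"
  proof -
    have "x \<in> closed_nbhd G y" if "x \<in> e - f" "y \<in> f - e" for x y
    proof -
      have "x \<in> verts G" "y \<in> verts G"
        using that uv closed_nbhd_subset[of u G] closed_nbhd_subset[of v G] by blast+
      then show ?thesis using full[OF that] sym[of x y] by simp
    qed
    then show ?thesis
      using key[of v u b a a'] uv adj ab sym[OF uv(1,2)] by blast
  qed
  moreover have "dependent_set (closed_nbhd_hypergraph G) e" "dependent_set (closed_nbhd_hypergraph G) f"
    using uv dependent_closed_nbhd by simp_all
  ultimately show False
    using two_asummable_exchange[OF asum] ab by blast
qed

theorem theorem3p6:
  fixes G :: "('a, 'b) pre_digraph"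
  assumes "graph G"
  shows "(domishold G \<longleftrightarrow> one_Sperner (closed_nbhd_hypergraph G)) \<and>
         (domishold G \<longleftrightarrow> threshold (closed_nbhd_hypergraph G)) \<and>
         (domishold G \<longleftrightarrow> two_asummable (closed_nbhd_hypergraph G))"
proof -
  interpret graph G by fact
  let ?H = "closed_nbhd_hypergraph G"
  have "hypergraph ?H" by (rule hypergraph_closed_nbhd_hypergraph)
  then have H: "finite (hverts ?H)" "hedges ?H \<subseteq> Pow (hverts ?H)"
    by (auto simp only: hypergraph_def)
  \<comment> \<open>Closes the cycle threshold, 2-asummable, 1-Sperner; domishold joins it at
    threshold. The unfolding passes from the record of the two fields to \<open>?H\<close>.\<close>
  have "one_Sperner ?H \<Longrightarrow> threshold ?H"
    using one_Sperner_imp_threshold[OF H] by (simp add: one_Sperner_def threshold_def)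
  then show ?thesis
    using domishold_iff_threshold threshold_imp_two_asummable[OF H(1)]
      two_asummable_imp_one_Sperner by blast
qed

end
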